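(* Let $\Gamma_A=(A,\alpha)$ and $\Gamma_B=(B,\beta)$ be two games, and let $i\in A$. The partial tensor product restricts to a well-defined map on preimputations $$(-\otimes_i-):X(\Gamma_A)\times X(\Gamma_B)\longrightarrow X(\Gamma_A\circ_i\Gamma_B).$$
   Context: A game is a pair $\Gamma=(N,v)$, $N$ a nonempty finite totally ordered set of players, $v:\mathcal P(N)\to\mathbb R$ with $v(\emptyset)=0$. Its set of preimputations is $X(\Gamma)=\{x\in\mathbb R^N:\sum_{j\in N}x_j=v(N)\}$. For games $(A,\alpha)$, $(B,\beta)$ with disjoint player sets and $i\in A$, the game $(A,\alpha)\circ_i(B,\beta)$ has player set $A\diamond_iB=(A\setminus\{i\})\cup B$ and coalition function $$(\alpha\circ_i\beta)(S)=\beta(B)\alpha(S\cap A)+\partial_i\alpha(S\cap A)\,\beta(S\cap B),\qquad \partial_i\alpha(T)=\alpha(T\cup\{i\})-\alpha(T\setminus\{i\}).$$ The partial tensor product of $x\in\mathbb R^A$ and $y\in\mathbb R^B$ is the vector $x\otimes_iy\in\mathbb R^{A\diamond_iB}$ with $(x\otimes_iy)_j=\big(\sum_{l\in B}y_l\big)x_j$ for $j\in A\setminus\{i\}$ and $(x\otimes_iy)_j=x_iy_j$ for $j\in B$. *)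

theory Defs
  imports Complex_Main "HOL-Library.FuncSet"
begin

record 'a game =
  players :: "'a set"
  player_order :: "'a rel"
  worth :: "'a set \<Rightarrow> real"

text \<open>
  Functions on a set \<open>N\<close> (payoff vectors) or on \<open>Pow N\<close> (coalition functions) are represented
  extensionally, so each of them has exactly one representative.
\<close>

definition is_game :: "'a game \<Rightarrow> bool" where
  "is_game \<Gamma> \<longleftrightarrow>
     finite (players \<Gamma>) \<and> players \<Gamma> \<noteq> {} \<and>
     linear_order_on (players \<Gamma>) (player_order \<Gamma>) \<and>
     worth \<Gamma> \<in> Pow (players \<Gamma>) \<rightarrow>\<^sub>E UNIV \<and>
     worth \<Gamma> {} = 0"

definition preimputations :: "'a game \<Rightarrow> ('a \<Rightarrow> real) set" where
  "preimputations \<Gamma> =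
     {x \<in> players \<Gamma> \<rightarrow>\<^sub>E UNIV. (\<Sum>j\<in>players \<Gamma>. x j) = worth \<Gamma> (players \<Gamma>)}"

definition marginal :: "('a set \<Rightarrow> real) \<Rightarrow> 'a \<Rightarrow> 'a set \<Rightarrow> real" where
  "marginal v i T = v (T \<union> {i}) - v (T - {i})"

definition subst_set :: "'a set \<Rightarrow> 'a \<Rightarrow> 'a set \<Rightarrow> 'a set" where
  "subst_set A i B = (A - {i}) \<union> B"

text \<open>
  The total order on \<^term>\<open>subst_set A i B\<close>: the block \<open>B\<close>, in its own order, takes the
  place of \<open>i\<close> in \<open>A\<close>.
\<close>

definition subst_order :: "'a set \<Rightarrow> 'a rel \<Rightarrow> 'a \<Rightarrow> 'a set \<Rightarrow> 'a rel \<Rightarrow> 'a rel" where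
  "subst_order A r i B s =
     {(a, b). a \<in> A - {i} \<and> b \<in> A - {i} \<and> (a, b) \<in> r} \<union>
     {(a, b). a \<in> B \<and> b \<in> B \<and> (a, b) \<in> s} \<union>
     {(a, b). a \<in> A - {i} \<and> b \<in> B \<and> (a, i) \<in> r} \<union>
     {(a, b). a \<in> B \<and> b \<in> A - {i} \<and> (i, b) \<in> r}"

definition game_comp :: "'a game \<Rightarrow> 'a \<Rightarrow> 'a game \<Rightarrow> 'a game" where
  "game_comp \<Gamma>A i \<Gamma>B =
     (let A = players \<Gamma>A; \<alpha> = worth \<Gamma>A; B = players \<Gamma>B; \<beta> = worth \<Gamma>B in
      \<lparr>players = subst_set A i B,
       player_order = subst_order A (player_order \<Gamma>A) i B (player_order \<Gamma>B),
       worth = (\<lambda>S\<in>Pow (subst_set A i B).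
                  \<beta> B * \<alpha> (S \<inter> A) + marginal \<alpha> i (S \<inter> A) * \<beta> (S \<inter> B))\<rparr>)"

definition partial_tensor ::
  "'a set \<Rightarrow> 'a \<Rightarrow> 'a set \<Rightarrow> ('a \<Rightarrow> real) \<Rightarrow> ('a \<Rightarrow> real) \<Rightarrow> 'a \<Rightarrow> real" where
  "partial_tensor A i B x y =
     (\<lambda>j\<in>subst_set A i B. if j \<in> B then x i * y j else (\<Sum>l\<in>B. y l) * x j)"

lemma linear_order_on_subst_order:
  assumes r: "linear_order_on A r" and s: "linear_order_on B s"
    and "i \<in> A" and "A \<inter> B = {}"
  shows "linear_order_on (subst_set A i B) (subst_order A r i B s)"
proof -
  have rr: "refl_on A r" "trans r" "antisym r" "total_on A r"
    and ss: "refl_on B s" "trans s" "antisym s" "total_on B s"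
    using r s by (auto simp: order_on_defs)
  have "refl_on (subst_set A i B) (subst_order A r i B s)"
    using rr(1) ss(1) by (auto simp: refl_on_def subst_set_def subst_order_def)
  moreover have "subst_order A r i B s \<subseteq> subst_set A i B \<times> subst_set A i B"
    by (auto simp: subst_set_def subst_order_def)
  moreover have "trans (subst_order A r i B s)"
  proof (rule transI)
    fix a b c
    assume ab: "(a, b) \<in> subst_order A r i B s" and bc: "(b, c) \<in> subst_order A r i B s"
    define p where "p = (\<lambda>a. if a \<in> B then i else a)"
    have iff: "(a, b) \<in> subst_order A r i B s \<longleftrightarrow>
        a \<in> subst_set A i B \<and> b \<in> subst_set A i B \<and>
        (if a \<in> B \<and> b \<in> B then (a, b) \<in> s else (p a, p b) \<in> r)" for a b
      using assms(4) by (auto simp: subst_order_def subst_set_def p_def)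
    have p_eq: "p a = i \<longleftrightarrow> a \<in> B" if "a \<in> subst_set A i B" for a
      using that by (auto simp: p_def subst_set_def)
    have le: "(p a, p b) \<in> r" if "(a, b) \<in> subst_order A r i B s" for a b
      using that refl_onD[OF rr(1) assms(3)] by (auto simp: iff p_def split: if_splits)
    have ac: "(p a, p c) \<in> r"
      using transD[OF rr(2) le[OF ab] le[OF bc]] .
    show "(a, c) \<in> subst_order A r i B s"
    proof (cases "a \<in> B \<and> c \<in> B")
      case True
      then have "p a = i" "p c = i" by (simp_all add: p_def)
      then have "p b = i"
        using antisymD[OF rr(3)] le[OF ab] le[OF bc] by metis
      then have "b \<in> B" using ab iff p_eq by blast
      then show ?thesis using True ab bc transD[OF ss(2)] unfolding iff by metis
    next
      case False
      then show ?thesis using ac ab bc unfolding iff by argo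
    qed
  qed
  moreover have "antisym (subst_order A r i B s)"
  proof (rule antisymI)
    fix a b
    assume "(a, b) \<in> subst_order A r i B s" "(b, a) \<in> subst_order A r i B s"
    then show "a = b"
      using antisymD[OF rr(3)] antisymD[OF ss(3)] assms(3,4)
      unfolding subst_order_def by blast
  qed
  moreover have "total_on (subst_set A i B) (subst_order A r i B s)"
  proof (rule total_onI)
    fix a b
    assume ab: "a \<in> subst_set A i B" "b \<in> subst_set A i B" "a \<noteq> b"
    note rt = rr(4)[unfolded total_on_def, rule_format]
    note st = ss(4)[unfolded total_on_def, rule_format]
    consider "a \<in> A - {i}" "b \<in> A - {i}" | "a \<in> B" "b \<in> B"
      | "a \<in> A - {i}" "b \<in> B" | "a \<in> B" "b \<in> A - {i}"
      using ab unfolding subst_set_def by blast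
    then show "(a, b) \<in> subst_order A r i B s \<or> (b, a) \<in> subst_order A r i B s"
    proof cases
      case 1
      then have "(a, b) \<in> r \<or> (b, a) \<in> r" using rt[of a b] ab(3) by simp
      then show ?thesis using 1 by (auto simp: subst_order_def)
    next
      case 2
      then have "(a, b) \<in> s \<or> (b, a) \<in> s" using st[of a b] ab(3) by simp
      then show ?thesis using 2 by (auto simp: subst_order_def)
    next
      case 3
      then have "(a, i) \<in> r \<or> (i, a) \<in> r" using rt[of a i] assms(3) by simp
      then show ?thesis using 3 by (auto simp: subst_order_def)
    next
      case 4
      then have "(b, i) \<in> r \<or> (i, b) \<in> r" using rt[of b i] assms(3) by simp
      then show ?thesis using 4 by (auto simp: subst_order_def)
    qed
  qed
  ultimately show ?thesis by (simp add: order_on_defs)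
qed

lemma is_game_game_comp:
  assumes A: "is_game \<Gamma>A" and B: "is_game \<Gamma>B"
    and "i \<in> players \<Gamma>A" and "players \<Gamma>A \<inter> players \<Gamma>B = {}"
  shows "is_game (game_comp \<Gamma>A i \<Gamma>B)"
proof -
  have "linear_order_on (players (game_comp \<Gamma>A i \<Gamma>B)) (player_order (game_comp \<Gamma>A i \<Gamma>B))"
    using assms linear_order_on_subst_order[of "players \<Gamma>A" _ "players \<Gamma>B" _ i]
    by (simp add: is_game_def game_comp_def Let_def)
  then show ?thesis
    using A B by (auto simp: is_game_def game_comp_def Let_def subst_set_def)
qed

end

theory Submission
  imports Defs
begin

text \<open>
  Both total payoff and worth of the grand coalition are multiplicative. The players of
  \<open>A - {i}\<close> receive their old payoffs scaled by the total of \<open>y\<close>, while the block \<open>B\<close>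
  jointly receives \<open>x i\<close> scaled by the same factor; so \<open>B\<close> as a whole stands in for \<open>i\<close>, and
  the total is the total of \<open>x\<close> times the total of \<open>y\<close> (lemma \<open>sum_partial_tensor\<close>). On the
  other side, the term \<open>\<beta> B * \<alpha> (A - {i})\<close> in the worth of the grand coalition of the
  composite cancels against the subtracted half of the marginal contribution of \<open>i\<close>, which leaves
  \<open>\<alpha> A * \<beta> B\<close> (lemma \<open>worth_grand_coalition_game_comp\<close>). For preimputations \<open>x\<close> and \<open>y\<close>
  the two products agree factor by factor.
\<close>

lemma players_game_comp:
  "players (game_comp \<Gamma>A i \<Gamma>B) = subst_set (players \<Gamma>A) i (players \<Gamma>B)"
  by (simp add: game_comp_def Let_def)

lemma worth_grand_coalition_game_comp:
  assumes "i \<in> players \<Gamma>A" and "players \<Gamma>A \<inter> players \<Gamma>B = {}"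
  shows "worth (game_comp \<Gamma>A i \<Gamma>B) (players (game_comp \<Gamma>A i \<Gamma>B)) =
           worth \<Gamma>A (players \<Gamma>A) * worth \<Gamma>B (players \<Gamma>B)"
proof -
  let ?A = "players \<Gamma>A" and ?B = "players \<Gamma>B"
  have "subst_set ?A i ?B \<inter> ?A = ?A - {i}" and "subst_set ?A i ?B \<inter> ?B = ?B"
    using assms(2) by (auto simp: subst_set_def)
  moreover have "marginal (worth \<Gamma>A) i (?A - {i}) = worth \<Gamma>A ?A - worth \<Gamma>A (?A - {i})"
    using assms(1) by (simp add: marginal_def insert_absorb)
  ultimately show ?thesis
    by (simp add: game_comp_def Let_def) (simp add: algebra_simps)
qed

lemma sum_partial_tensor:
  assumes "finite A" and "finite B" and "i \<in> A" and "A \<inter> B = {}"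
  shows "(\<Sum>j\<in>subst_set A i B. partial_tensor A i B x y j) = (\<Sum>j\<in>A. x j) * (\<Sum>l\<in>B. y l)"
proof -
  have "(\<Sum>j\<in>subst_set A i B. partial_tensor A i B x y j) =
      (\<Sum>j\<in>A - {i}. partial_tensor A i B x y j) + (\<Sum>j\<in>B. partial_tensor A i B x y j)"
    unfolding subst_set_def using assms by (intro sum.union_disjoint) auto
  also have "(\<Sum>j\<in>A - {i}. partial_tensor A i B x y j) = (\<Sum>j\<in>A - {i}. (\<Sum>l\<in>B. y l) * x j)"
    using assms(4) by (intro sum.cong) (auto simp: partial_tensor_def subst_set_def)
  also have "(\<Sum>j\<in>B. partial_tensor A i B x y j) = (\<Sum>j\<in>B. x i * y j)"
    by (intro sum.cong) (auto simp: partial_tensor_def subst_set_def)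
  also have "(\<Sum>j\<in>A - {i}. (\<Sum>l\<in>B. y l) * x j) + (\<Sum>j\<in>B. x i * y j) =
      (x i + (\<Sum>j\<in>A - {i}. x j)) * (\<Sum>l\<in>B. y l)"
    by (simp flip: sum_distrib_left) (simp add: algebra_simps)
  also have "x i + (\<Sum>j\<in>A - {i}. x j) = (\<Sum>j\<in>A. x j)"
    using assms(1,3) by (simp add: sum.remove)
  finally show ?thesis .
qed

theorem lemma4:
  fixes \<Gamma>A \<Gamma>B :: "'a game" and i :: 'a
  assumes "is_game \<Gamma>A" and "is_game \<Gamma>B"
    and "players \<Gamma>A \<inter> players \<Gamma>B = {}"
    and "i \<in> players \<Gamma>A"
  shows "(\<lambda>(x, y). partial_tensor (players \<Gamma>A) i (players \<Gamma>B) x y)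
           \<in> preimputations \<Gamma>A \<times> preimputations \<Gamma>B \<rightarrow> preimputations (game_comp \<Gamma>A i \<Gamma>B)"
proof -
  have "partial_tensor (players \<Gamma>A) i (players \<Gamma>B) x y \<in> preimputations (game_comp \<Gamma>A i \<Gamma>B)"
    if x: "x \<in> preimputations \<Gamma>A" and y: "y \<in> preimputations \<Gamma>B" for x y
  proof -
    let ?z = "partial_tensor (players \<Gamma>A) i (players \<Gamma>B) x y"
    have "(\<Sum>j\<in>players (game_comp \<Gamma>A i \<Gamma>B). ?z j) =
        (\<Sum>j\<in>players \<Gamma>A. x j) * (\<Sum>l\<in>players \<Gamma>B. y l)"
      unfolding players_game_comp
      using assms by (intro sum_partial_tensor) (auto simp: is_game_def)
    also have "\<dots> = worth \<Gamma>A (players \<Gamma>A) * worth \<Gamma>B (players \<Gamma>B)"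
      using x y by (simp add: preimputations_def)
    also have "\<dots> = worth (game_comp \<Gamma>A i \<Gamma>B) (players (game_comp \<Gamma>A i \<Gamma>B))"
      using worth_grand_coalition_game_comp assms(3,4) by metis
    finally have "(\<Sum>j\<in>players (game_comp \<Gamma>A i \<Gamma>B). ?z j) =
        worth (game_comp \<Gamma>A i \<Gamma>B) (players (game_comp \<Gamma>A i \<Gamma>B))" .
    moreover have "?z \<in> players (game_comp \<Gamma>A i \<Gamma>B) \<rightarrow>\<^sub>E UNIV"
      by (simp add: players_game_comp partial_tensor_def)
    ultimately show ?thesis
      by (simp add: preimputations_def)
  qed
  then show ?thesis by auto
qed

end
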